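(* Consider a system of $n\ge 2$ oblivious fully synchronous robots with chirality, and let $C_0$ be an initial configuration. Then \textsc{Move-All} is solvable in $1$ step from $C_0$ if and only if $C_0\notin\mathcal C_\odot$, and likewise \textsc{Visit-All} is solvable in $1$ step from $C_0$ if and only if $C_0\notin\mathcal C_\odot$.
   Context: Model. There are $n\ge 2$ robots $r_0,\dots,r_{n-1}$, which are points in $\mathbb R^2$. A configuration is a tuple $C=(p_0,\dots,p_{n-1})$ of points, $p_i$ being the position of $r_i$ in a fixed global coordinate system unknown to the robots; an initial configuration consists of pairwise distinct points. Each robot $r_i$ has a local Cartesian coordinate system $Z_i$, always centred at its current position, whose orientation and unit length are fixed over time but arbitrary and possibly different for different robots. Chirality: all $Z_i$ have the same handedness (the robots agree on the clockwise direction). Robots are anonymous, oblivious and deterministic: an algorithm $\mathcal A$ is one function, the same for all robots, mapping a snapshot (the multiset of positions of all robots expressed in the observing robot's local coordinate system, its own position being the origin) to a destination point (in the same local coordinates). In each round all robots simultaneously take a snapshot, compute their destination, and move exactly to it. Thus $C_0$ and $Z=(Z_0,\dots,Z_{n-1})$ determine the run $(C_0,C_1,C_2,\dots)$ of $\mathcal A$. Permutations. For a permutation $\pi$ of $\{0,\dots,n-1\}$ put $\pi(C)=(p_{\pi(0)},\dots,p_{\pi(n-1)})$. $\Pi_2$ is the set of permutations without fixed points, and $\Pi_n$ is the set of permutations that are a single $n$-cycle. Problems. $\mathcal A$ solves \textsc{Move-All} (resp. \textsc{Visit-All}) in $1$ step from $C_0$ if for every admissible $Z$ the run from $C_0$ satisfies: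 there is $\pi\in\Pi_2$ (resp. $\pi\in\Pi_n$) with $C_i=\pi^i(C_0)$ for all $i\ge 0$. The problem is solvable in $1$ step from $C_0$ if some algorithm does this. $\mathcal C_\odot$ is the set of configurations $C$ having exactly one robot $r_c$ (the central robot) at the centre of the smallest circle enclosing $C$, and such that for some integer $k>1$ the rotation by $2\pi/k$ about the position of $r_c$ maps the multiset of points of $C$ to itself (so $n\ge 3$). *)

theory Defs
  imports "HOL-Analysis.Analysis" "HOL-Combinatorics.Permutations" "HOL-Combinatorics.Orbits"
begin

text \<open>The plane is the type \<^typ>\<open>complex\<close>; a configuration of \<open>n\<close> robots is a list of length \<open>n\<close>
  whose \<open>i\<close>-th entry is the position of robot \<open>i\<close>.\<close>

type_synonym configuration = "complex list"

text \<open>A local coordinate system is given by its first basis vector \<open>axis\<close>, in global coordinates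
  (so that \<open>cmod (axis F)\<close> is the unit length and \<open>axis F / cmod (axis F)\<close> the orientation),
  and by its handedness relative to the global system, which fixes the second basis vector as
  \<open>\<i> * axis F\<close> or \<open>- \<i> * axis F\<close>. The origin is not part of it: it is always the current position
  of the robot.\<close>

datatype frame = Frame (axis: complex) (mirrored: bool)

definition to_global :: "frame \<Rightarrow> complex \<Rightarrow> complex" where
  "to_global F z = axis F * (if mirrored F then cnj z else z)"

definition to_local :: "frame \<Rightarrow> complex \<Rightarrow> complex" where
  "to_local F v = (if mirrored F then cnj (v / axis F) else v / axis F)"

lemma to_global_to_local: "axis F \<noteq> 0 \<Longrightarrow> to_global F (to_local F v) = v"
  by (simp add: to_global_def to_local_def)

lemma to_local_to_global: "axis F \<noteq> 0 \<Longrightarrow> to_local F (to_global F z) = z"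
  by (simp add: to_global_def to_local_def)

text \<open>Chirality: the common handedness is arbitrary and not known to the robots.\<close>

definition admissible :: "nat \<Rightarrow> (nat \<Rightarrow> frame) \<Rightarrow> bool" where
  "admissible n Z \<longleftrightarrow>
     (\<forall>i<n. axis (Z i) \<noteq> 0) \<and> (\<forall>i<n. \<forall>j<n. mirrored (Z i) = mirrored (Z j))"

type_synonym algorithm = "complex multiset \<Rightarrow> complex"

definition snapshot :: "frame \<Rightarrow> complex \<Rightarrow> configuration \<Rightarrow> complex multiset" where
  "snapshot F p C = image_mset (\<lambda>q. to_local F (q - p)) (mset C)"

definition step :: "algorithm \<Rightarrow> (nat \<Rightarrow> frame) \<Rightarrow> configuration \<Rightarrow> configuration" where
  "step A Z C =
     map (\<lambda>i. C ! i + to_global (Z i) (A (snapshot (Z i) (C ! i) C))) [0..<length C]"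

definition run :: "algorithm \<Rightarrow> (nat \<Rightarrow> frame) \<Rightarrow> configuration \<Rightarrow> nat \<Rightarrow> configuration" where
  "run A Z C0 t = (step A Z ^^ t) C0"

definition fixpoint_free_perms :: "nat \<Rightarrow> (nat \<Rightarrow> nat) set" where
  "fixpoint_free_perms n = {\<pi>. \<pi> permutes {..<n} \<and> (\<forall>i<n. \<pi> i \<noteq> i)}"

definition full_cycle_perms :: "nat \<Rightarrow> (nat \<Rightarrow> nat) set" where
  "full_cycle_perms n = {\<pi>. \<pi> permutes {..<n} \<and> cyclic_on \<pi> {..<n}}"

definition solves :: "(nat \<Rightarrow> (nat \<Rightarrow> nat) set) \<Rightarrow> algorithm \<Rightarrow> configuration \<Rightarrow> bool" where
  "solves P A C0 \<longleftrightarrow>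
     (\<forall>Z. admissible (length C0) Z \<longrightarrow>
        (\<exists>\<pi>\<in>P (length C0). \<forall>t. run A Z C0 t = permute_list (\<pi> ^^ t) C0))"

definition move_all_solvable :: "configuration \<Rightarrow> bool" where
  "move_all_solvable C0 \<longleftrightarrow> (\<exists>A. solves fixpoint_free_perms A C0)"

definition visit_all_solvable :: "configuration \<Rightarrow> bool" where
  "visit_all_solvable C0 \<longleftrightarrow> (\<exists>A. solves full_cycle_perms A C0)"

definition smallest_enclosing_circle :: "complex \<Rightarrow> real \<Rightarrow> configuration \<Rightarrow> bool" where
  "smallest_enclosing_circle c r C \<longleftrightarrow>
     set C \<subseteq> cball c r \<and> (\<forall>c' r'. set C \<subseteq> cball c' r' \<longrightarrow> r \<le> r')"

definition rotation_about :: "complex \<Rightarrow> real \<Rightarrow> complex \<Rightarrow> complex" where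
  "rotation_about c \<theta> q = c + cis \<theta> * (q - c)"

text \<open>The length condition only excludes the degenerate case of a single robot.\<close>

definition C_odot :: "configuration set" where
  "C_odot = {C. 2 \<le> length C \<and>
     (\<exists>c r. smallest_enclosing_circle c r C \<and> count (mset C) c = 1 \<and>
        (\<exists>k::nat. k > 1 \<and>
           image_mset (rotation_about c (2 * pi / real k)) (mset C) = mset C))}"

end

theory Submission imports Defs
begin

text \<open>Put the centroid of the configuration at the origin. The numbers \<open>w\<close> with \<open>w T = T\<close> form a
  finite multiplicative group, hence are the \<open>m\<close>-th roots of unity for some \<open>m\<close>, and outside
  \<open>C_odot\<close> this group acts freely on \<open>T\<close>. Listing \<open>q\<close> orbit representatives \<open>h 0, \<dots>, h (q - 1)\<close> and
  putting \<open>e i = \<omega>^(i div q) * h (i mod q)\<close> for a primitive root \<open>\<omega>\<close> makes a shift by \<open>q\<close> the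
  multiplication by \<open>\<omega>\<close>; so \<open>e i \<mapsto> e (i + 1)\<close> is a single cycle on \<open>T\<close> commuting with all symmetries.
  Choosing such a cycle for one representative of each class \<open>{a T | a \<noteq> 0}\<close> and transporting it
  gives a rule that commutes with all changes of coordinates, so that every robot can evaluate it
  in its own frame.

  Conversely, let a configuration be symmetric about the robot \<open>c\<close>, and choose frames that
  respect the symmetry. Some robot has to move to \<open>c\<close>; but then all its images under the rotation
  do so as well, and the move is not injective.\<close>

subsection \<open>Equivariant cycles\<close>

text \<open>Evaluation at \<open>z\<close> embeds the stabilizer \<open>G\<close> into
  \<open>T\<close>, so \<open>G\<close> is finite. Multiplication by \<open>w\<close> permutes
  \<open>G\<close>; comparing the products over \<open>G\<close> gives \<open>w ^ m = 1\<close> for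
  \<open>m = card G\<close>, and as there are only \<open>m\<close> such roots, counting gives
  equality.\<close>

lemma mult_stabilizer_eq_roots_unity:
  fixes T :: "complex set"
  assumes "finite T" "z \<in> T" "z \<noteq> 0"
  obtains m where "m > 0" "{w. (*) w ` T = T} = {w. w ^ m = 1}"
proof -
  define G where "G = {w. (*) w ` T = T}"
  have "inj_on (\<lambda>w. w * z) G" using \<open>z \<noteq> 0\<close> by (auto simp: inj_on_def)
  moreover have "(\<lambda>w. w * z) ` G \<subseteq> T" using \<open>z \<in> T\<close> by (auto simp: G_def)
  ultimately have fin: "finite G" using \<open>finite T\<close> by (meson inj_on_finite)
  have nz: "w \<noteq> 0" if "w \<in> G" for w
    using that assms by (auto simp: G_def)
  have mult: "v * w \<in> G" if "v \<in> G" "w \<in> G" for v w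
  proof -
    have "(*) (v * w) ` T = (*) v ` (*) w ` T" by (simp add: image_image mult.assoc)
    with that show ?thesis by (simp add: G_def)
  qed
  have "1 \<in> G" by (simp add: G_def)
  define m where "m = card G"
  have "m > 0" using fin \<open>1 \<in> G\<close> by (auto simp: m_def card_gt_0_iff)
  have "w ^ m = 1" if "w \<in> G" for w
  proof -
    have inj: "inj_on ((*) w) G" using nz[OF that] by (simp add: inj_on_def)
    then have "(*) w ` G = G"
      using mult[OF that] fin by (intro endo_inj_surj) auto
    then have "\<Prod>G = (\<Prod>v\<in>G. w * v)" using prod.reindex[OF inj, of id] by simp
    also have "\<dots> = w ^ m * \<Prod>G" by (simp add: prod.distrib m_def)
    finally show ?thesis using nz fin by simp
  qed
  then have "G \<subseteq> {w. w ^ m = 1}" by auto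
  moreover have "card {w::complex. w ^ m = 1} = card G"
    using card_roots_unity_eq[OF \<open>m > 0\<close>] by (simp add: m_def)
  ultimately have "G = {w. w ^ m = 1}"
    using \<open>m > 0\<close> by (intro card_subset_eq finite_roots_unity) auto
  with \<open>m > 0\<close> show thesis using that by (auto simp: G_def)
qed

lemma cis_root_unity_power_eq_1_iff:
  assumes "m > 0"
  shows "cis (2 * pi / real m) ^ j = 1 \<longleftrightarrow> m dvd j"
proof -
  let ?w = "cis (2 * pi / real m)"
  have w: "?w ^ k = cis (2 * pi * real k / real m)" for k
    by (simp only: Complex.DeMoivre times_divide_eq_right) (simp only: mult_ac)
  have "?w ^ m = 1" using assms by (simp add: w)
  then have "?w ^ j = ?w ^ (j mod m)"
    by (metis div_mult_mod_eq mult.commute mult_1 power_add power_mult power_one)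
  also have "\<dots> = 1 \<longleftrightarrow> j mod m = 0"
  proof
    assume "?w ^ (j mod m) = 1"
    then have "cis (2 * pi * real (j mod m) / real m) = cis (2 * pi * real 0 / real m)"
      by (simp add: w)
    then show "j mod m = 0"
      by (rule inj_onD[OF bij_betw_imp_inj_on[OF Complex.bij_betw_roots_unity[OF assms]]])
        (use assms in auto)
  qed simp
  finally show ?thesis by auto
qed

text \<open>An index \<open>i\<close> encodes an orbit, \<open>i mod q\<close>, and an exponent,
  \<open>i div q\<close>. Freeness gives every orbit exactly \<open>m\<close> points, so the period
  \<open>n\<close> is \<open>q * m\<close>.\<close>

lemma free_cyclic_action_enumeration:
  fixes T :: "complex set" and \<omega> :: complex
  assumes "finite T" "T \<noteq> {}" "m > 0"
    and \<omega>: "\<And>j. \<omega> ^ j = 1 \<longleftrightarrow> m dvd j"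
    and closed: "\<forall>x\<in>T. \<omega> * x \<in> T"
    and free: "\<forall>x\<in>T. \<forall>j. \<omega> ^ j * x = x \<longrightarrow> \<omega> ^ j = 1"
  obtains e :: "nat \<Rightarrow> complex" and n q
  where "n > 0" "range e = T" "\<forall>i j. e i = e j \<longleftrightarrow> i mod n = j mod n" "\<forall>i. e (i + q) = \<omega> * e i"
proof -
  have nz: "\<omega> \<noteq> 0" using \<omega>[of m] \<open>m > 0\<close> by (auto simp: power_0_left)
  have closed_pow: "\<omega> ^ j * x \<in> T" if "x \<in> T" for x j
    using that closed by (induction j) (auto simp: mult.assoc)
  have pow_mod: "\<omega> ^ j = \<omega> ^ (j mod m)" for j
    using \<omega>[of "m * (j div m)"] by (metis dvd_triv_left mult_1 mult_div_mod_eq power_add)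
  define orb where "orb x = range (\<lambda>j. \<omega> ^ j * x)" for x
  have orb_pow: "orb (\<omega> ^ k * x) = orb x" for k x
  proof -
    have "\<omega> ^ j * (\<omega> ^ k * x) \<in> orb x" for j
      unfolding orb_def mult.assoc[symmetric] power_add[symmetric] by blast
    moreover have "\<omega> ^ j * x \<in> orb (\<omega> ^ k * x)" for j
    proof -
      have "\<omega> ^ (m * k) = 1" using \<omega> by simp
      moreover have "k \<le> m * k" using \<open>m > 0\<close> by simp
      \<comment> \<open>The natural number \<open>m * k - k\<close> plays the part of the exponent
        \<open>-k\<close>.\<close>
      ultimately have "\<omega> ^ (j + (m * k - k)) * \<omega> ^ k = \<omega> ^ j"
        by (metis add.assoc le_add_diff_inverse2 mult_1_right power_add)
      then have "\<omega> ^ (j + (m * k - k)) * (\<omega> ^ k * x) = \<omega> ^ j * x"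
        by (simp add: mult.assoc[symmetric])
      then show ?thesis unfolding orb_def by (metis rangeI)
    qed
    ultimately show ?thesis by (auto simp: orb_def)
  qed
  \<comment> \<open>The choice depends only on the set \<open>orb x\<close>, so \<open>r\<close> is
    constant on orbits and idempotent.\<close>
  define r where "r x = (SOME y. y \<in> orb x)" for x
  have r: "r x \<in> orb x" for x
    unfolding r_def by (rule someI[of _ x]) (auto simp: orb_def intro!: image_eqI[of _ _ 0])
  have orb_r: "orb (r x) = orb x" for x
  proof -
    obtain j where "r x = \<omega> ^ j * x" using r[of x] by (auto simp: orb_def)
    then show ?thesis by (simp add: orb_pow)
  qed
  have r_r: "r (r x) = r x" for x
    using orb_r[of x] unfolding r_def by simp
  define R where "R = r ` T"
  have "finite R" using \<open>finite T\<close> by (simp add: R_def)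
  have RT: "R \<subseteq> T"
  proof
    fix y assume "y \<in> R"
    then obtain x where "x \<in> T" "y = r x" by (auto simp: R_def)
    then show "y \<in> T" using r[of x] closed_pow by (auto simp: orb_def)
  qed
  define q where "q = card R"
  have "q > 0" using \<open>finite R\<close> \<open>T \<noteq> {}\<close> by (auto simp: q_def R_def card_gt_0_iff)
  obtain h where h: "bij_betw h {..<q} R"
    using ex_bij_betw_nat_finite[OF \<open>finite R\<close>] by (auto simp: q_def atLeast0LessThan)
  define e where "e i = \<omega> ^ (i div q) * h (i mod q)" for i
  have hR: "h (i mod q) \<in> R" for i using h \<open>q > 0\<close> by (auto simp: bij_betw_def)
  show thesis
  proof
    show "q * m > 0" using \<open>q > 0\<close> \<open>m > 0\<close> by simp
    show "\<forall>i. e (i + q) = \<omega> * e i" using \<open>q > 0\<close> by (simp add: e_def)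
    show "range e = T"
    proof (intro equalityI subsetI)
      fix x assume "x \<in> T"
      then have "r x \<in> R" by (simp add: R_def)
      then obtain k where k: "k < q" "h k = r x" using h by (force simp: bij_betw_def)
      have "x \<in> orb (r x)" unfolding orb_r by (auto simp: orb_def intro!: image_eqI[of _ _ 0])
      then obtain j where "x = \<omega> ^ j * r x" by (auto simp: orb_def)
      then have "x = e (j * q + k)" using k by (simp add: e_def)
      then show "x \<in> range e" by simp
    qed (use hR RT closed_pow in \<open>auto simp: e_def\<close>)
    show "\<forall>i j. e i = e j \<longleftrightarrow> i mod (q * m) = j mod (q * m)"
    proof (intro allI iffI)
      fix i j assume eq: "e i = e j"
      then have "orb (h (i mod q)) = orb (h (j mod q))" using orb_pow by (metis e_def)
      then have "r (h (i mod q)) = r (h (j mod q))" by (simp add: r_def)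
      then have "h (i mod q) = h (j mod q)" using hR[of i] hR[of j] r_r by (auto simp: R_def)
      then have mods: "i mod q = j mod q"
        using h \<open>q > 0\<close> by (auto simp: bij_betw_def dest!: inj_onD)
      define x where "x = h (j mod q)"
      have "x \<in> T" using hR RT by (auto simp: x_def)
      have key: "a mod m = b mod m" if "a \<le> b" "\<omega> ^ a * x = \<omega> ^ b * x" for a b
      proof -
        have "\<omega> ^ a * (\<omega> ^ (b - a) * x) = \<omega> ^ a * x"
          using that by (auto simp add: mult.assoc[symmetric] power_add[symmetric])
        then have "\<omega> ^ (b - a) * x = x" using nz by simp
        then have "m dvd b - a" using free \<open>x \<in> T\<close> \<omega> by blast
        then show ?thesis using \<open>a \<le> b\<close> by (metis mod_eq_dvd_iff_nat)
      qed
      have "\<omega> ^ (i div q) * x = \<omega> ^ (j div q) * x"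
        using eq mods unfolding e_def x_def by simp
      then have "i div q mod m = j div q mod m"
        using key[of "i div q" "j div q"] key[of "j div q" "i div q"] by (metis nle_le)
      with mods show "i mod (q * m) = j mod (q * m)" by (simp add: mod_mult2_eq)
    next
      fix i j assume eq: "i mod (q * m) = j mod (q * m)"
      then have "i mod q = j mod q" by (metis dvd_triv_left mod_mod_cancel)
      moreover from this eq have "i div q mod m = j div q mod m"
        using \<open>q > 0\<close> by (simp add: mod_mult2_eq)
      ultimately show "e i = e j" unfolding e_def using pow_mod by metis
    qed
  qed
qed

text \<open>Symmetries are multiplications because the centre sits at 0 and, by chirality, any two
  frames differ only by translation, rotation and scaling.\<close>

definition equivariant_cycle :: "complex set \<Rightarrow> (complex \<Rightarrow> complex) \<Rightarrow> bool" where
  "equivariant_cycle T f \<longleftrightarrow>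
     cyclic_on f T \<and> (\<forall>w. (*) w ` T = T \<longrightarrow> (\<forall>x\<in>T. f (w * x) = w * f x))"

text \<open>Only the point 0 can be fixed by a multiplication other than the identity, so
  \<open>rigid\<close> is exactly freeness of the action. The successor map of the enumeration
  \<open>e\<close> then commutes with the shift by \<open>q\<close>, which is multiplication by
  \<open>\<omega>\<close>.\<close>

lemma equivariant_cycle_exists:
  fixes T :: "complex set"
  assumes "finite T" "z \<in> T" "z \<noteq> 0"
    and rigid: "\<And>w. 0 \<in> T \<Longrightarrow> (*) w ` T = T \<Longrightarrow> w = 1"
  shows "\<exists>f. equivariant_cycle T f"
proof -
  obtain m where m: "m > 0" and G: "{w. (*) w ` T = T} = {w. w ^ m = 1}"
    using mult_stabilizer_eq_roots_unity[OF assms(1-3)] .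
  define \<omega> where "\<omega> = cis (2 * pi / real m)"
  have \<omega>: "\<omega> ^ j = 1 \<longleftrightarrow> m dvd j" for j
    unfolding \<omega>_def by (rule cis_root_unity_power_eq_1_iff[OF m])
  have stab: "(*) (\<omega> ^ j) ` T = T" for j
  proof -
    have "(\<omega> ^ j) ^ m = 1" using \<omega>[of "j * m"] by (simp add: power_mult)
    then show ?thesis using G by blast
  qed
  have closed: "\<forall>x\<in>T. \<omega> * x \<in> T" using stab[of 1] by auto
  have free: "\<forall>x\<in>T. \<forall>j. \<omega> ^ j * x = x \<longrightarrow> \<omega> ^ j = 1"
  proof (intro ballI allI impI)
    fix x j assume "x \<in> T" "\<omega> ^ j * x = x"
    then show "\<omega> ^ j = 1" using stab[of j] rigid by (cases "x = 0") auto
  qed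
  have "T \<noteq> {}" using \<open>z \<in> T\<close> by blast
  obtain e :: "nat \<Rightarrow> complex" and n q where n: "n > 0" and e: "range e = T"
    and e_eq: "\<forall>i j. e i = e j \<longleftrightarrow> i mod n = j mod n"
    and e_shift: "\<forall>i. e (i + q) = \<omega> * e i"
    using free_cyclic_action_enumeration[OF \<open>finite T\<close> \<open>T \<noteq> {}\<close> m \<omega> closed free] .
  note eq = e_eq[rule_format] and eq_shift = e_shift[rule_format]
  \<comment> \<open>The chosen index does not matter: indices of the same point agree modulo
    \<open>n\<close>, hence so do their successors.\<close>
  define f where "f x = e (Suc (SOME i. e i = x))" for x
  have f: "f (e i) = e (Suc i)" for i
  proof -
    have "e (SOME k. e k = e i) = e i" by (rule someI[of "\<lambda>k. e k = e i" i]) simp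
    then show ?thesis unfolding f_def eq by (metis mod_Suc_eq)
  qed
  have pow: "(f ^^ k) (e i) = e (k + i)" for k i
    by (induction k) (simp_all add: f)
  have "T \<subseteq> orbit f (e 0)"
  proof
    fix x assume "x \<in> T"
    then obtain i where "x = e i" using e by auto
    \<comment> \<open>Adding the period \<open>n\<close> makes the exponent positive, since
      \<open>orbit\<close> collects positive iterates only.\<close>
    also have "\<dots> = (f ^^ (i + n)) (e 0)" by (simp add: pow eq)
    finally show "x \<in> orbit f (e 0)" using n by (auto simp: orbit_altdef)
  qed
  moreover have "orbit f (e 0) \<subseteq> T" using e by (auto simp: orbit_altdef pow)
  ultimately have cyc: "cyclic_on f T" using e by (auto simp: cyclic_on_def)
  have equi: "f (\<omega> ^ k * e i) = \<omega> ^ k * f (e i)" for k i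
  proof (induction k arbitrary: i)
    case (Suc k)
    have "f (\<omega> ^ Suc k * e i) = f (\<omega> ^ k * e (i + q))" by (simp add: eq_shift mult_ac)
    also have "\<dots> = \<omega> ^ k * e (Suc i + q)" by (simp add: Suc f)
    also have "\<dots> = \<omega> ^ Suc k * f (e i)" unfolding eq_shift by (simp add: f)
    finally show ?case .
  qed simp
  have "f (w * x) = w * f x" if w: "(*) w ` T = T" and x: "x \<in> T" for w x
  proof -
    have "w ^ m = 1" using G w by blast
    then obtain k where "w = cis (2 * pi * real k / real m)"
      using bij_betw_imp_surj_on[OF Complex.bij_betw_roots_unity[OF m]] by blast
    then have "w = \<omega> ^ k" by (simp add: \<omega>_def Complex.DeMoivre mult_ac)
    moreover obtain i where "x = e i" using e x by auto
    ultimately show ?thesis using equi by simp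
  qed
  with cyc show ?thesis by (auto simp: equivariant_cycle_def)
qed

section \<open>Canonical cycles, one choice per class of sets up to scaling and rotation\<close>

lemma equivariant_cycle_scale:
  assumes f: "equivariant_cycle T f" and "a \<noteq> 0"
  shows "equivariant_cycle ((*) a ` T) (\<lambda>x. a * f (x / a))"
proof -
  have "cyclic_on (\<lambda>x. a * f (x / a)) ((*) a ` T)"
    using f \<open>a \<noteq> 0\<close> by (auto simp: equivariant_cycle_def intro: cyclic_on_image)
  moreover have "a * f (w * x / a) = w * (a * f (x / a))"
    if stab: "(*) w ` (*) a ` T = (*) a ` T" and x: "x \<in> (*) a ` T" for w x
  proof -
    obtain y where y: "y \<in> T" "x = a * y" using x by auto
    \<comment> \<open>Multiplications commute, so a symmetry of the scaled set is a symmetry of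
      \<open>T\<close>.\<close>
    have "(*) a ` (*) w ` T = (*) a ` T"
      using stab by (simp add: image_image mult_ac)
    then have "(*) w ` T = T"
      using \<open>a \<noteq> 0\<close> by (subst (asm) inj_image_eq_iff) (auto simp: inj_def)
    with f y \<open>a \<noteq> 0\<close> show ?thesis by (simp add: equivariant_cycle_def)
  qed
  ultimately show ?thesis by (simp add: equivariant_cycle_def)
qed

text \<open>The predicate under \<open>SOME\<close> depends only on the class of \<open>T\<close>,
  so sets differing by a nonzero factor get the very same representative.\<close>

definition class_rep :: "complex set \<Rightarrow> complex set" where
  "class_rep T = (SOME U. \<exists>a. a \<noteq> 0 \<and> U = (*) a ` T)"

text \<open>This factor is determined only up to symmetries of \<open>T\<close>; equivariance of the
  chosen cycle absorbs the ambiguity.\<close>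

definition class_scale :: "complex set \<Rightarrow> complex" where
  "class_scale T = (SOME a. a \<noteq> 0 \<and> class_rep T = (*) a ` T)"

definition canonical_cycle :: "complex set \<Rightarrow> complex \<Rightarrow> complex" where
  "canonical_cycle T x =
     (SOME f. equivariant_cycle (class_rep T) f) (class_scale T * x) / class_scale T"

lemma class_scale: "class_scale T \<noteq> 0" "class_rep T = (*) (class_scale T) ` T"
proof -
  have "\<exists>a. a \<noteq> 0 \<and> class_rep T = (*) a ` T"
    unfolding class_rep_def by (rule someI[of _ T]) (auto intro: exI[of _ 1])
  then have "class_scale T \<noteq> 0 \<and> class_rep T = (*) (class_scale T) ` T"
    unfolding class_scale_def by (rule someI_ex)
  then show "class_scale T \<noteq> 0" "class_rep T = (*) (class_scale T) ` T" by auto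
qed

lemma class_rep_scale:
  assumes "b \<noteq> 0"
  shows "class_rep ((*) b ` T) = class_rep T"
proof -
  have "(\<exists>a. a \<noteq> 0 \<and> U = (*) a ` (*) b ` T) \<longleftrightarrow> (\<exists>a. a \<noteq> 0 \<and> U = (*) a ` T)" for U
  proof
    assume "\<exists>a. a \<noteq> 0 \<and> U = (*) a ` (*) b ` T"
    then obtain a where "a \<noteq> 0" "U = (*) (a * b) ` T" by (auto simp: image_image mult_ac)
    with assms show "\<exists>a. a \<noteq> 0 \<and> U = (*) a ` T" by (intro exI[of _ "a * b"]) simp
  next
    assume "\<exists>a. a \<noteq> 0 \<and> U = (*) a ` T"
    then obtain a where "a \<noteq> 0" "U = (*) a ` T" by auto
    with assms show "\<exists>a. a \<noteq> 0 \<and> U = (*) a ` (*) b ` T"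
      by (intro exI[of _ "a / b"]) (simp add: image_image)
  qed
  then show ?thesis by (simp add: class_rep_def)
qed

lemma equivariant_cycle_class_rep:
  assumes "\<exists>f. equivariant_cycle T f"
  shows "equivariant_cycle (class_rep T) (SOME f. equivariant_cycle (class_rep T) f)"
  using assms equivariant_cycle_scale class_scale[of T] by (metis someI_ex)

lemma canonical_cycle_cyclic:
  assumes "\<exists>f. equivariant_cycle T f"
  shows "cyclic_on (canonical_cycle T) T"
proof -
  have "equivariant_cycle ((*) (1 / class_scale T) ` class_rep T) (canonical_cycle T)"
    using equivariant_cycle_scale[OF equivariant_cycle_class_rep[OF assms], of "1 / class_scale T"] class_scale(1)[of T]
    unfolding canonical_cycle_def by (simp add: mult_ac)
  moreover have "(*) (1 / class_scale T) ` class_rep T = T"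
    using class_scale[of T] by (simp add: image_image)
  ultimately show ?thesis by (simp add: equivariant_cycle_def)
qed

text \<open>Both sets share their representative, but the factors \<open>s\<close> and
  \<open>s' * b\<close> leading from \<open>T\<close> to it may differ. Their quotient is a symmetry
  of the representative, so the chosen cycle commutes with it.\<close>

lemma canonical_cycle_scale:
  assumes ex: "\<exists>f. equivariant_cycle T f" and b: "b \<noteq> 0" and "x \<in> T"
  shows "canonical_cycle ((*) b ` T) (b * x) = b * canonical_cycle T x"
proof -
  define f where "f = (SOME f. equivariant_cycle (class_rep T) f)"
  define s s' where "s = class_scale T" and "s' = class_scale ((*) b ` T)"
  have s: "s \<noteq> 0" "class_rep T = (*) s ` T" using class_scale by (auto simp: s_def)
  have s': "s' \<noteq> 0" "class_rep T = (*) s' ` (*) b ` T"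
    using class_scale[of "(*) b ` T"] class_rep_scale[OF b] by (auto simp: s'_def)
  have f: "equivariant_cycle (class_rep T) f" using equivariant_cycle_class_rep[OF ex] by (simp add: f_def)
  have "(*) (s' * b / s) ` class_rep T = class_rep T"
    using s by (subst (1) s(2), subst s'(2)) (simp add: image_image mult_ac)
  moreover have "s * x \<in> class_rep T" using s \<open>x \<in> T\<close> by simp
  ultimately have "f (s' * b / s * (s * x)) = s' * b / s * f (s * x)"
    using f unfolding equivariant_cycle_def by blast
  then have "f (s' * (b * x)) = s' * b / s * f (s * x)" using s by (simp add: mult_ac)
  then show ?thesis
    using s' unfolding canonical_cycle_def class_rep_scale[OF b] f_def[symmetric] s_def[symmetric]
      s'_def[symmetric] by simp
qed

subsection \<open>Symmetry and the smallest enclosing circle\<close>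

text \<open>An occupied centre of rotational symmetry is automatically the centre of the smallest
  enclosing circle. This lets the algorithm work with the centroid, although \<open>C_odot\<close>
  speaks of that circle.\<close>

lemma symmetric_imp_C_odot:
  assumes "distinct C" "length C \<ge> 2" "c \<in> set C"
    and T: "T = (\<lambda>z. z - c) ` set C" and w: "(*) w ` T = T" "w \<noteq> 1"
  shows "C \<in> C_odot"
proof -
  have "finite T" by (simp add: T)
  have "card (set C) \<ge> 2" using assms by (simp add: distinct_card)
  then have "\<not> set C \<subseteq> {c}" using card_mono[of "{c}" "set C"] by auto
  then obtain y where "y \<in> set C" "y \<noteq> c" by blast
  then obtain z where z: "z \<in> T" "z \<noteq> 0" using that[of "y - c"] by (auto simp: T)
  obtain m where "m > 0" and m: "{w. (*) w ` T = T} = {w. w ^ m = 1}"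
    using mult_stabilizer_eq_roots_unity[OF \<open>finite T\<close> z] .
  have "w ^ m = 1" using w m by blast
  with \<open>w \<noteq> 1\<close> \<open>m > 0\<close> have "m > 1" by (cases "m = 1") auto
  define \<omega> where "\<omega> = cis (2 * pi / real m)"
  have "\<omega> ^ m = 1" using cis_root_unity_power_eq_1_iff[OF \<open>m > 0\<close>] by (simp add: \<omega>_def)
  then have stab: "(*) \<omega> ` T = T" using m by blast
  have set_C: "set C = (\<lambda>t. c + t) ` T" by (simp add: T image_image)
  have "rotation_about c (2 * pi / real m) ` set C = (\<lambda>t. c + t) ` (*) \<omega> ` T"
    by (simp add: set_C image_image rotation_about_def \<omega>_def)
  then have "rotation_about c (2 * pi / real m) ` set C = set C"
    by (simp add: stab set_C)
  moreover have "inj_on (rotation_about c (2 * pi / real m)) (set C)"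
    by (auto simp: inj_on_def rotation_about_def)
  ultimately have sym: "image_mset (rotation_about c (2 * pi / real m)) (mset C) = mset C"
    using \<open>distinct C\<close> by (simp add: mset_set_set[symmetric] image_mset_mset_set)
  define r where "r = Max (cmod ` T)"
  have "r \<in> cmod ` T" unfolding r_def using \<open>finite T\<close> z by (intro Max_in) auto
  \<comment> \<open>A farthest point \<open>t\<close> realizes the radius, so bounding
    \<open>cmod t\<close> by \<open>r'\<close> is enough.\<close>
  then obtain t where t: "t \<in> T" "cmod t = r" by auto
  have "smallest_enclosing_circle c r C"
    unfolding smallest_enclosing_circle_def
  proof (intro conjI allI impI)
    show "set C \<subseteq> cball c r"
      using \<open>finite T\<close> by (auto simp: T r_def dist_norm norm_minus_commute)
  next
    fix c' r' assume sub: "set C \<subseteq> cball c' r'"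
    define U where "U = {v::complex. v ^ m = 1}"
    \<comment> \<open>By symmetry \<open>C\<close> also lies in the discs centred at the rotated copies of \<open>c'\<close>, and these
      centres average to \<open>c\<close>.\<close>
    have "cmod (v * (c' - c) - t) \<le> r'" if "v \<in> U" for v
    proof -
      have "v \<noteq> 0" "(1 / v) ^ m = 1"
        using that \<open>m > 0\<close> by (auto simp: U_def power_divide power_0_left)
      then have "(*) (1 / v) ` T = T" using m by blast
      then have "1 / v * t \<in> T" using t by blast
      then have "c + t / v \<in> set C" by (auto simp: set_C)
      then have *: "cmod (c' - (c + t / v)) \<le> r'" using sub by (auto simp: dist_norm)
      have "cmod v = 1"
        using that \<open>m > 0\<close> power_eq_1_iff[of v m] by (simp add: U_def)
      moreover have "v * (c' - c) - t = v * (c' - (c + t / v))"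
        using \<open>v \<noteq> 0\<close> by (simp add: algebra_simps)
      ultimately show ?thesis using * by (simp add: norm_mult)
    qed
    then have "cmod (\<Sum>v\<in>U. v * (c' - c) - t) \<le> real (card U) * r'"
      using sum_norm_le[of U "\<lambda>v. v * (c' - c) - t" "\<lambda>_. r'"] by simp
    \<comment> \<open>As \<open>m > 1\<close> the roots of unity sum to 0, so the rotated centres
      cancel and \<open>m\<close> copies of \<open>t\<close> remain.\<close>
    moreover have "(\<Sum>v\<in>U. v * (c' - c) - t) = - (of_nat m * t)"
      using sum_roots_unity[OF \<open>m > 1\<close>] card_roots_unity_eq[OF \<open>m > 0\<close>]
      by (simp add: sum_subtractf sum_distrib_right[symmetric] U_def)
    ultimately have "real m * r \<le> real m * r'"
      using t card_roots_unity_eq[OF \<open>m > 0\<close>] by (simp add: norm_mult U_def)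
    then show "r \<le> r'" using \<open>m > 0\<close> by simp
  qed
  moreover have "count (mset C) c = 1"
    using \<open>distinct C\<close> \<open>c \<in> set C\<close> by (simp add: distinct_count_atmost_1)
  ultimately show ?thesis
    unfolding C_odot_def using sym \<open>m > 1\<close> \<open>length C \<ge> 2\<close> by blast
qed

subsection \<open>The algorithm\<close>

text \<open>It serves as common origin because it can be computed from a snapshot and moves along
  with every change of coordinates.\<close>

definition centroid :: "complex set \<Rightarrow> complex" where
  "centroid T = \<Sum>T / of_nat (card T)"

definition centred :: "complex set \<Rightarrow> complex set" where
  "centred T = (\<lambda>z. z - centroid T) ` T"

definition cycle_move :: "complex set \<Rightarrow> complex \<Rightarrow> complex" where
  "cycle_move T p = centroid T + canonical_cycle (centred T) (p - centroid T)"

lemma centroid_affine: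
  assumes "finite T" "T \<noteq> {}" "a \<noteq> 0"
  shows "centroid ((\<lambda>z. a * (z - p)) ` T) = a * (centroid T - p)"
proof -
  have inj: "inj_on (\<lambda>z. a * (z - p)) T" using \<open>a \<noteq> 0\<close> by (auto simp: inj_on_def)
  have "\<Sum>((\<lambda>z. a * (z - p)) ` T) = a * (\<Sum>T - of_nat (card T) * p)"
    by (simp add: sum.reindex[OF inj] sum_distrib_left[symmetric] sum_subtractf)
  moreover have "card T \<noteq> 0" using assms by simp
  ultimately show ?thesis
    unfolding centroid_def card_image[OF inj] by (simp add: field_simps)
qed

text \<open>The map \<open>a * (z - p)\<close> is the passage to an unmirrored frame at
  \<open>p\<close> with axis \<open>1 / a\<close>. Centring removes the translation, and
  \<open>canonical_cycle_scale\<close> handles the factor \<open>a\<close>.\<close>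

lemma cycle_move_affine:
  assumes T: "finite T" and a: "a \<noteq> 0" and ex: "\<exists>f. equivariant_cycle (centred T) f" and "x \<in> T"
  shows "cycle_move ((\<lambda>z. a * (z - p)) ` T) (a * (x - p)) = a * (cycle_move T x - p)"
proof -
  have "T \<noteq> {}" using \<open>x \<in> T\<close> by blast
  note c = centroid_affine[OF T this a]
  have "centred ((\<lambda>z. a * (z - p)) ` T) = (*) a ` centred T"
    unfolding centred_def c by (simp add: image_image algebra_simps)
  moreover have "a * (x - p) - a * (centroid T - p) = a * (x - centroid T)"
    by (simp add: algebra_simps)
  moreover have "x - centroid T \<in> centred T" using \<open>x \<in> T\<close> by (simp add: centred_def)
  ultimately show ?thesis
    using canonical_cycle_scale[OF ex a, of "x - centroid T"]
    unfolding cycle_move_def c by (simp add: algebra_simps)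
qed

lemma cycle_move_cyclic:
  assumes "\<exists>f. equivariant_cycle (centred T) f"
  shows "cyclic_on (cycle_move T) T"
proof -
  have "cyclic_on (cycle_move T) ((\<lambda>z. centroid T + z) ` centred T)"
    using canonical_cycle_cyclic[OF assms] by (rule cyclic_on_image) (simp add: cycle_move_def)
  then show ?thesis by (simp add: centred_def image_image)
qed

section \<open>Mirrored frames and the move seen globally\<close>

lemma equivariant_cycle_cnj:
  assumes "equivariant_cycle T f"
  shows "equivariant_cycle (cnj ` T) (\<lambda>z. cnj (f (cnj z)))"
proof -
  have "cyclic_on (\<lambda>z. cnj (f (cnj z))) (cnj ` T)"
    using assms by (auto simp: equivariant_cycle_def intro: cyclic_on_image)
  moreover have "cnj (f (cnj (w * x))) = w * cnj (f (cnj x))"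
    if stab: "(*) w ` cnj ` T = cnj ` T" and x: "x \<in> cnj ` T" for w x
  proof -
    \<comment> \<open>A symmetry \<open>w\<close> of the mirror image corresponds to the symmetry
      \<open>cnj w\<close> of \<open>T\<close>.\<close>
    have "(*) (cnj w) ` T = cnj ` (*) w ` cnj ` T" by (simp add: image_image)
    then have "(*) (cnj w) ` T = T" by (simp only: stab) (simp add: image_image)
    moreover have "cnj x \<in> T" using x by auto
    ultimately show ?thesis using assms by (simp add: equivariant_cycle_def)
  qed
  ultimately show ?thesis by (simp add: equivariant_cycle_def)
qed

lemma centred_cnj: "centred (cnj ` T) = cnj ` centred T"
proof -
  have "inj_on cnj T" by (simp add: inj_on_def)
  then have "centroid (cnj ` T) = cnj (centroid T)"
    by (simp add: centroid_def sum.reindex card_image)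
  then show ?thesis by (simp add: centred_def image_image)
qed

text \<open>The argument \<open>0\<close> is the robot's own position in its snapshot.\<close>

definition cycle_algorithm :: algorithm where
  "cycle_algorithm M = cycle_move (set_mset M) 0"

text \<open>The canonical cycles need not commute with reflections, so the global cycle may depend
  on the handedness; chirality makes it the same for all robots.\<close>

definition global_move :: "bool \<Rightarrow> complex set \<Rightarrow> complex \<Rightarrow> complex" where
  "global_move mir S p = (if mir then cnj (cycle_move (cnj ` S) (cnj p)) else cycle_move S p)"

lemma global_move_cyclic:
  assumes "\<exists>f. equivariant_cycle (centred S) f"
  shows "cyclic_on (global_move mir S) S"
proof (cases mir)
  case True
  have "\<exists>f. equivariant_cycle (centred (cnj ` S)) f"
    using assms equivariant_cycle_cnj unfolding centred_cnj by blast
  then have "cyclic_on (global_move mir S) (cnj ` cnj ` S)"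
    by (intro cyclic_on_image[OF cycle_move_cyclic]) (simp_all add: global_move_def True)
  then show ?thesis by (simp add: image_image)
next
  case False
  then show ?thesis using cycle_move_cyclic[OF assms] by (simp add: global_move_def[abs_def])
qed

lemma to_global_cycle_algorithm:
  assumes ex: "\<exists>f. equivariant_cycle (centred (set C)) f" and F: "axis F \<noteq> 0" and p: "p \<in> set C"
  shows "p + to_global F (cycle_algorithm (snapshot F p C)) = global_move (mirrored F) (set C) p"
proof (cases "mirrored F")
  case True
  have "\<exists>f. equivariant_cycle (centred (cnj ` set C)) f"
    using ex equivariant_cycle_cnj unfolding centred_cnj by blast
  from cycle_move_affine[OF _ _ this, of "1 / cnj (axis F)" "cnj p" "cnj p"] F p
  show ?thesis
    by (simp add: cycle_algorithm_def snapshot_def to_local_def to_global_def global_move_def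
        True image_image)
next
  case False
  from cycle_move_affine[OF _ _ ex, of "1 / axis F" p p] F p
  show ?thesis
    by (simp add: cycle_algorithm_def snapshot_def to_local_def to_global_def global_move_def
        False)
qed

section \<open>From cyclic maps on positions to permutations of robots\<close>

lemma cyclic_on_imp_bij_betw:
  assumes "cyclic_on f S"
  shows "bij_betw f S S"
proof -
  have "S \<subseteq> f ` S"
  proof
    fix y assume "y \<in> S"
    then have "S = orbit f y" using assms by (simp add: cyclic_on_alldef)
    with \<open>y \<in> S\<close> have "y \<in> orbit f y" by simp
    \<comment> \<open>Both introduction rules of \<open>orbit\<close> exhibit \<open>y\<close> as an
      image under \<open>f\<close>.\<close>
    then show "y \<in> f ` S" using \<open>S = orbit f y\<close> \<open>y \<in> S\<close> by cases auto
  qed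
  moreover have "f ` S \<subseteq> S" using cyclic_on_inI[OF assms] by blast
  ultimately have "f ` S = S" by blast
  with finite_cyclic_on[OF assms] show ?thesis
    by (simp add: bij_betw_def eq_card_imp_inj_on)
qed

lemma cyclic_on_list_index:
  assumes "distinct C" "cyclic_on f (set C)"
  obtains \<pi> where "\<pi> \<in> full_cycle_perms (length C)"
    "\<And>i. i < length C \<Longrightarrow> f (C ! i) = C ! \<pi> i"
proof -
  let ?n = "length C"
  have bij: "bij_betw ((!) C) {..<?n} (set C)" using \<open>distinct C\<close> by (simp add: bij_betw_nth)
  define idx where "idx = inv_into {..<?n} ((!) C)"
  have bij_idx: "bij_betw idx (set C) {..<?n}"
    unfolding idx_def by (rule bij_betw_inv_into[OF bij])
  have nth_idx: "C ! idx x = x" if "x \<in> set C" for x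
    unfolding idx_def by (rule bij_betw_inv_into_right[OF bij that])
  \<comment> \<open>The default value \<open>i\<close> is there because \<open>permutes\<close>
    demands the identity outside the index range.\<close>
  define \<pi> where "\<pi> i = (if i < ?n then idx (f (C ! i)) else i)" for i
  have "cyclic_on \<pi> (idx ` set C)"
    using assms(2)
  proof (rule cyclic_on_image)
    fix x assume x: "x \<in> set C"
    then have "idx x < ?n" using bij_idx by (auto simp: bij_betw_def)
    with x show "\<pi> (idx x) = idx (f x)" by (simp add: \<pi>_def nth_idx)
  qed
  then have cyc: "cyclic_on \<pi> {..<?n}" using bij_idx by (simp add: bij_betw_def)
  then have "\<pi> permutes {..<?n}"
    by (intro bij_imp_permutes cyclic_on_imp_bij_betw) (simp_all add: \<pi>_def)
  moreover have "f (C ! i) = C ! \<pi> i" if "i < ?n" for i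
    using that cyclic_on_inI[OF assms(2), of "C ! i"] by (simp add: \<pi>_def nth_idx)
  ultimately show thesis using that cyc by (auto simp: full_cycle_perms_def)
qed

lemma cycle_algorithm_solves:
  assumes "distinct C0" and ex: "\<exists>f. equivariant_cycle (centred (set C0)) f"
  shows "solves full_cycle_perms cycle_algorithm C0"
  unfolding solves_def
proof (intro allI impI)
  fix Z assume Z: "admissible (length C0) Z"
  let ?n = "length C0"
  define f where "f = global_move (mirrored (Z 0)) (set C0)"
  obtain \<pi> where \<pi>: "\<pi> \<in> full_cycle_perms ?n"
    and f: "\<And>i. i < ?n \<Longrightarrow> f (C0 ! i) = C0 ! \<pi> i"
    using cyclic_on_list_index[OF \<open>distinct C0\<close> global_move_cyclic[OF ex]] unfolding f_def by blast
  have perm: "\<pi> permutes {..<?n}" using \<pi> by (simp add: full_cycle_perms_def)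
  \<comment> \<open>Every later configuration lists the same points as \<open>C0\<close>, and
    \<open>f\<close> depends on that set only, so each round applies the same \<open>f\<close>
    despite obliviousness.\<close>
  have step: "step cycle_algorithm Z C = map f C" if "set C = set C0" "length C = ?n" for C
  proof (rule nth_equalityI)
    fix i assume "i < length (step cycle_algorithm Z C)"
    then have i: "i < ?n" "i < length C" using that by (simp_all add: step_def)
    then have "axis (Z i) \<noteq> 0" "mirrored (Z i) = mirrored (Z 0)"
      using Z unfolding admissible_def by (blast, metis gr_implies_not0 not_gr0)
    moreover have "C ! i \<in> set C0" using i that(1) by (metis nth_mem)
    ultimately show "step cycle_algorithm Z C ! i = map f C ! i"
      using i that ex to_global_cycle_algorithm[of C "Z i" "C ! i"] by (simp add: step_def f_def)
  qed (simp add: step_def)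
  have "run cycle_algorithm Z C0 t = permute_list (\<pi> ^^ t) C0" for t
  proof (induction t)
    case 0
    then show ?case by (simp add: run_def)
  next
    case (Suc t)
    have perm_t: "\<pi> ^^ t permutes {..<?n}"
      using perm by (induction t) (auto intro: permutes_compose simp: permutes_id)
    have "run cycle_algorithm Z C0 (Suc t) = step cycle_algorithm Z (permute_list (\<pi> ^^ t) C0)"
      using Suc by (simp add: run_def)
    also have "\<dots> = map f (permute_list (\<pi> ^^ t) C0)"
      using perm_t by (intro step) simp_all
    also have "\<dots> = permute_list (\<pi> ^^ Suc t) C0"
      using permutes_in_image[OF perm_t] by (auto simp: permute_list_def f)
    finally show ?case .
  qed
  with \<pi> show "\<exists>\<pi>\<in>full_cycle_perms ?n. \<forall>t. run cycle_algorithm Z C0 t = permute_list (\<pi> ^^ t) C0"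
    by blast
qed

text \<open>If the centroid is unoccupied, the action on the centred set is free; if it is occupied,
  a nontrivial symmetry would put \<open>C0\<close> into \<open>C_odot\<close>.\<close>

lemma visit_all_solvable_if_not_C_odot:
  assumes "distinct C0" "length C0 \<ge> 2" "C0 \<notin> C_odot"
  shows "visit_all_solvable C0"
proof -
  define c T where "c = centroid (set C0)" and "T = centred (set C0)"
  have T: "T = (\<lambda>z. z - c) ` set C0" by (simp add: T_def c_def centred_def)
  then have "finite T" by simp
  have "card (set C0) \<ge> 2" using assms by (simp add: distinct_card)
  then have "\<not> set C0 \<subseteq> {c}" using card_mono[of "{c}" "set C0"] by auto
  then obtain y where "y \<in> set C0" "y \<noteq> c" by blast
  then obtain z where z: "z \<in> T" "z \<noteq> 0" using that[of "y - c"] by (auto simp: T)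
  have "w = 1" if "0 \<in> T" "(*) w ` T = T" for w
  proof (rule ccontr)
    assume "w \<noteq> 1"
    moreover have "c \<in> set C0" using that(1) by (auto simp: T)
    ultimately show False using symmetric_imp_C_odot[OF _ _ _ T that(2)] assms by blast
  qed
  from equivariant_cycle_exists[OF \<open>finite T\<close> z this]
  show ?thesis
    using cycle_algorithm_solves[OF \<open>distinct C0\<close>] by (auto simp: visit_all_solvable_def T_def)
qed

subsection \<open>Solvability\<close>

lemma full_cycle_perms_subset:
  assumes "n \<ge> 2"
  shows "full_cycle_perms n \<subseteq> fixpoint_free_perms n"
proof
  fix \<pi> assume \<pi>: "\<pi> \<in> full_cycle_perms n"
  have "\<pi> i \<noteq> i" if "i < n" for i
  proof
    assume "\<pi> i = i"
    then have "orbit \<pi> i = {i}" by (simp add: orbit_eq_singleton_iff)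
    then have "{..<n} = {i}" using \<pi> that by (auto simp: full_cycle_perms_def cyclic_on_alldef)
    then have "card {..<n} = card {i}" by (rule arg_cong)
    with assms show False by simp
  qed
  with \<pi> show "\<pi> \<in> fixpoint_free_perms n"
    by (simp add: full_cycle_perms_def fixpoint_free_perms_def)
qed

lemma visit_all_imp_move_all:
  assumes "length C0 \<ge> 2" "visit_all_solvable C0"
  shows "move_all_solvable C0"
  using assms full_cycle_perms_subset
  unfolding visit_all_solvable_def move_all_solvable_def solves_def by blast

text \<open>The contradiction already arises in the first round, for one well-chosen family of
  frames.\<close>

lemma not_move_all_solvable_if_C_odot:
  assumes "distinct C0" "C0 \<in> C_odot"
  shows "\<not> move_all_solvable C0"
proof
  let ?n = "length C0"
  assume "move_all_solvable C0"
  then obtain A where A: "solves fixpoint_free_perms A C0" by (auto simp: move_all_solvable_def)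
  obtain c k where c: "count (mset C0) c = 1" and k: "k > 1"
    and sym: "image_mset (rotation_about c (2 * pi / real k)) (mset C0) = mset C0"
    using \<open>C0 \<in> C_odot\<close> by (auto simp: C_odot_def)
  define w where "w = cis (2 * pi / real k)"
  define \<rho> where "\<rho> = rotation_about c (2 * pi / real k)"
  have \<rho>: "\<rho> q = c + w * (q - c)" for q by (simp add: \<rho>_def w_def rotation_about_def)
  have "w \<noteq> 0" by (simp add: w_def)
  have "w \<noteq> 1" using cis_root_unity_power_eq_1_iff[of k 1] k by (simp add: w_def)
  \<comment> \<open>The frames turn with the configuration, so that all robots of one orbit see the same.\<close>
  define Z where "Z i = Frame (if C0 ! i = c then 1 else C0 ! i - c) False" for i
  \<comment> \<open>The value \<open>1\<close> for the central robot keeps its axis nonzero.\<close>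
  have "admissible ?n Z" by (simp add: admissible_def Z_def)
  then obtain \<pi> where \<pi>: "\<pi> \<in> fixpoint_free_perms ?n"
    and run: "\<And>t. run A Z C0 t = permute_list (\<pi> ^^ t) C0"
    using A by (auto simp: solves_def)
  have perm: "\<pi> permutes {..<?n}" using \<pi> by (simp add: fixpoint_free_perms_def)
  have "step A Z C0 = permute_list \<pi> C0" using run[of 1] by (simp add: run_def)
  then have move: "C0 ! i + to_global (Z i) (A (snapshot (Z i) (C0 ! i) C0)) = C0 ! \<pi> i"
    if "i < ?n" for i
  proof -
    have "C0 ! i + to_global (Z i) (A (snapshot (Z i) (C0 ! i) C0)) = step A Z C0 ! i"
      using that by (simp add: step_def)
    also have "\<dots> = C0 ! \<pi> i"
      unfolding \<open>step A Z C0 = permute_list \<pi> C0\<close> using perm that by (rule permute_list_nth)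
    finally show ?thesis .
  qed
  have "c \<in> set C0" using c count_eq_zero_iff[of "mset C0" c] by auto
  then obtain ic where ic: "ic < ?n" "C0 ! ic = c" by (auto simp: in_set_conv_nth)
  \<comment> \<open>Robot \<open>i\<close> is the one that must take over the centre in the first
    round.\<close>
  obtain i where i: "\<pi> i = ic" using permutes_surj[OF perm] by (metis surjD)
  then have "i < ?n" using ic permutes_in_image[OF perm, of i] by simp
  note i = this i
  have "i \<noteq> ic" using i \<pi> by (auto simp: fixpoint_free_perms_def)
  define p where "p = C0 ! i"
  have "p \<noteq> c" using \<open>i \<noteq> ic\<close> i ic \<open>distinct C0\<close> by (auto simp: p_def nth_eq_iff_index_eq)
  have "set_mset (image_mset \<rho> (mset C0)) = set C0" using sym by (simp add: \<rho>_def)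
  then have "\<rho> p \<in> set C0" using i by (auto simp: p_def)
  then obtain j where j: "j < ?n" "C0 ! j = \<rho> p" by (auto simp: in_set_conv_nth)
  have "\<rho> p \<noteq> c" using \<open>p \<noteq> c\<close> \<open>w \<noteq> 0\<close> by (simp add: \<rho>)
  have Zi: "Z i = Frame (p - c) False" using \<open>p \<noteq> c\<close> by (simp add: Z_def p_def)
  have Zj: "Z j = Frame (\<rho> p - c) False" using \<open>\<rho> p \<noteq> c\<close> j by (simp add: Z_def)
  \<comment> \<open>Symmetry allows \<open>mset C0\<close> to be replaced by its rotated image; the
    factor \<open>w\<close> then cancels in every quotient.\<close>
  have "snapshot (Z j) (\<rho> p) C0 = image_mset (\<lambda>q. (q - \<rho> p) / (\<rho> p - c)) (image_mset \<rho> (mset C0))"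
    using sym by (simp add: snapshot_def Zj to_local_def \<rho>_def)
  also have "\<dots> = image_mset (\<lambda>q. (\<rho> q - \<rho> p) / (\<rho> p - c)) (mset C0)"
    by (simp add: image_mset.compositionality comp_def)
  also have "(\<lambda>q. (\<rho> q - \<rho> p) / (\<rho> p - c)) = (\<lambda>q. (q - p) / (p - c))"
  proof
    fix q
    have "\<rho> q - \<rho> p = w * (q - p)" "\<rho> p - c = w * (p - c)" by (simp_all add: \<rho> algebra_simps)
    then show "(\<rho> q - \<rho> p) / (\<rho> p - c) = (q - p) / (p - c)" using \<open>w \<noteq> 0\<close> by simp
  qed
  also have "image_mset (\<lambda>q. (q - p) / (p - c)) (mset C0) = snapshot (Z i) p C0"
    by (simp add: snapshot_def Zi to_local_def)
  finally have snap: "snapshot (Z j) (\<rho> p) C0 = snapshot (Z i) p C0" .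
  have "p + (p - c) * A (snapshot (Z i) p C0) = c"
    using move[OF i(1)] i(2) ic(2) by (simp add: to_global_def Zi p_def)
  then have "(p - c) * (A (snapshot (Z i) p C0) + 1) = 0" by (simp add: algebra_simps)
  \<comment> \<open>In the frames of \<open>i\<close> and \<open>j\<close> alike, the centre has the
    local coordinate \<open>-1\<close>.\<close>
  then have "A (snapshot (Z i) p C0) = - 1"
    using \<open>p \<noteq> c\<close> by (simp add: eq_neg_iff_add_eq_0)
  then have "C0 ! \<pi> j = c"
    using move[OF j(1)] j(2) snap by (simp add: to_global_def Zj)
  moreover have "\<pi> j < ?n" using permutes_in_image[OF perm] j by simp
  ultimately have "\<pi> j = \<pi> i" using ic i \<open>distinct C0\<close> by (metis nth_eq_iff_index_eq)
  then have "j = i" using permutes_inj[OF perm] by (simp add: inj_eq)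
  then have "(w - 1) * (p - c) = 0" using j(2) by (simp add: p_def[symmetric] \<rho> algebra_simps)
  with \<open>w \<noteq> 1\<close> \<open>p \<noteq> c\<close> show False by simp
qed

theorem theorem3:
  fixes n :: nat and C0 :: configuration
  assumes "n \<ge> 2" and "length C0 = n" and "distinct C0"
  shows "(move_all_solvable C0 \<longleftrightarrow> C0 \<notin> C_odot) \<and> (visit_all_solvable C0 \<longleftrightarrow> C0 \<notin> C_odot)"
  using assms visit_all_solvable_if_not_C_odot visit_all_imp_move_all
    not_move_all_solvable_if_C_odot by blast

end
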